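(* Let $X,\tilde X\in\{0,1\}^{n\times p}$ be the one-hot encodings of a true and a predicted (proxy) categorical regressor, each row containing exactly one entry equal to $1$. Let $\mathbf y=X\boldsymbol\beta+\boldsymbol\epsilon$ with $\boldsymbol\beta\in\mathbb R^p$, $\mathbb E[\boldsymbol\epsilon\mid X]=\mathbf 0$ and $\operatorname{Var}(\boldsymbol\epsilon\mid X)=\sigma^2I_n$. Put $E=\tilde X-X$ and $\tilde{\boldsymbol\beta}=(\tilde X^\top\tilde X)^{-1}\tilde X^\top\mathbf y$. Then, for each category $j\in\{1,\dots,p\}$, the bias in the estimated coefficient for category $j$ due to misclassification is given by $$\big[-(\tilde X^\top\tilde X)^{-1}\tilde X^\top E\boldsymbol\beta\big]_j=-\beta_j+\frac{(n_j-n_{\mathrm{out},j})\beta_j+\sum_{k\ne j}n_{k\to j}\beta_k}{\tilde n_j}.$$ Equivalently, the systematic (noise-free) component of the proxy-based estimator admits the mixture representation $$\mathbb E[\tilde\beta_j\mid X,\tilde X]=\frac{(n_j-n_{\mathrm{out},j})\beta_j+\sum_{k\ne j}n_{k\to j}\beta_k}{\tilde n_j},$$ which follows from $\mathbb E[\boldsymbol\epsilon\mid X]=\mathbf 0$ under the model. Thus $\tilde\beta_j$ is a weighted mixture of the true effect $\beta_j$ and the effects $\beta_k$ of the other categories $k\ne j$ that are misclassified into category $j$.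
   Context: There are $n$ observations and $p$ categories. $n_j=\sum_iX_{ij}$ is the number of observations truly in category $j$; $\tilde n_j=\sum_i\tilde X_{ij}$ is the number predicted as category $j$; $n_{k\to j}=\#\{i:X_{ik}=1,\ \tilde X_{ij}=1\}$ is the number of observations truly in category $k$ and predicted as category $j$; $n_{\mathrm{out},j}=\sum_{k\ne j}n_{j\to k}$ is the number of observations truly in category $j$ that are misclassified into some other category. One has $\tilde X^\top\tilde X=\operatorname{diag}(\tilde n_1,\dots,\tilde n_p)$, which is taken to be invertible (every $\tilde n_j>0$). The systematic (noise-free) component of $\tilde{\boldsymbol\beta}$ means $\mathbb E[\tilde{\boldsymbol\beta}\mid X,\tilde X]$, the part of $\tilde{\boldsymbol\beta}$ other than the sampling-noise term $(\tilde X^\top\tilde X)^{-1}\tilde X^\top\boldsymbol\epsilon$.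
   Formalization: The formula for E[β̃_j | X, X̃] is proved under the added assumption E[ε | X, X̃] = E[ε | X] almost surely, since E[ε | X] = 0 alone does not imply it when X̃ may depend on ε; the bias formula needs no such assumption. *)

theory Defs
  imports "HOL-Analysis.Analysis" "HOL-Probability.Probability"
begin

definition one_hot :: "real^'p^'n \<Rightarrow> bool" where
  "one_hot X \<longleftrightarrow> (\<forall>i. (\<forall>j. X $ i $ j \<in> {0, 1}) \<and> (\<exists>!j. X $ i $ j = 1))"

definition category_count :: "real^'p^'n \<Rightarrow> 'p \<Rightarrow> real" where
  "category_count X j = (\<Sum>i\<in>UNIV. X $ i $ j)"

text \<open>\<open>flow_count X Xt k j\<close>: observations truly in \<open>k\<close> and predicted as \<open>j\<close>.\<close>

definition flow_count :: "real^'p^'n \<Rightarrow> real^'p^'n \<Rightarrow> 'p \<Rightarrow> 'p \<Rightarrow> nat" where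
  "flow_count X Xt k j = card {i. X $ i $ k = 1 \<and> Xt $ i $ j = 1}"

definition out_count :: "real^'p^'n \<Rightarrow> real^'p^'n \<Rightarrow> 'p \<Rightarrow> nat" where
  "out_count X Xt j = (\<Sum>k\<in>UNIV - {j}. flow_count X Xt j k)"

definition ols :: "real^'p^'n \<Rightarrow> real^'n \<Rightarrow> real^'p" where
  "ols Z y = (matrix_inv (transpose Z ** Z) ** transpose Z) *v y"

definition sigma_gen :: "'a measure \<Rightarrow> ('a \<Rightarrow> 'b::topological_space) \<Rightarrow> 'a measure" where
  "sigma_gen M Z = vimage_algebra (space M) Z borel"

text \<open>Versions of the conditional mean vector \<open>E[v | Z]\<close> and the conditional covariance
  matrix \<open>Var(v | Z)\<close>; both are determined only up to null sets, and are meaningful only when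
  the entries (respectively their squares) are integrable.\<close>

definition cond_mean ::
  "'a measure \<Rightarrow> ('a \<Rightarrow> 'b::topological_space) \<Rightarrow> ('a \<Rightarrow> real^'m) \<Rightarrow> 'a \<Rightarrow> real^'m" where
  "cond_mean M Z v \<omega> = (\<chi> i. real_cond_exp M (sigma_gen M Z) (\<lambda>w. v w $ i) \<omega>)"

definition cond_var ::
  "'a measure \<Rightarrow> ('a \<Rightarrow> 'b::topological_space) \<Rightarrow> ('a \<Rightarrow> real^'m) \<Rightarrow> 'a \<Rightarrow> real^'m^'m" where
  "cond_var M Z v \<omega> = (\<chi> i k. real_cond_exp M (sigma_gen M Z)
     (\<lambda>w. (v w $ i - cond_mean M Z v w $ i) * (v w $ k - cond_mean M Z v w $ k)) \<omega>)"

end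

(* The Gram matrix of a one-hot design is diagonal with the category counts on the diagonal, so
   each row of the least-squares matrix averages over one predicted category. Applied to X \<beta>, the
   average over predicted category j weights \<beta>_k by the flow from k to j. For the conditional mean,
   the averaging weights are bounded functions of the two designs and can be pulled out of the
   conditional expectation of the noise. *)

theory Submission
  imports Defs
begin

section \<open>One-hot rows, the Gram matrix and its inverse\<close>

lemma one_hot_cases: "one_hot Z \<Longrightarrow> Z $ i $ j = 0 \<or> Z $ i $ j = 1"
  by (auto simp: one_hot_def)

text \<open>Entries are idempotent, and no row has a 1 in two distinct columns. Summed over the
  rows, this is the orthogonality of the columns.\<close>

lemma one_hot_row_mult:
  assumes "one_hot Z"
  shows "Z $ i $ j * Z $ i $ k = (if j = k then Z $ i $ j else 0)"
proof (cases "j = k")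
  case True
  then show ?thesis using one_hot_cases[OF assms, of i j] by auto
next
  case False
  then have "Z $ i $ j \<noteq> 1 \<or> Z $ i $ k \<noteq> 1"
    using assms unfolding one_hot_def by blast
  with False show ?thesis
    using one_hot_cases[OF assms, of i j] one_hot_cases[OF assms, of i k] by auto
qed

lemma one_hot_row_sum:
  fixes Z :: "real^'p^'n"
  assumes "one_hot Z"
  shows "(\<Sum>j\<in>UNIV. Z $ i $ j) = 1"
proof -
  obtain j where j: "Z $ i $ j = 1" and uniq: "\<forall>k. Z $ i $ k = 1 \<longrightarrow> k = j"
    using assms unfolding one_hot_def by metis
  have "Z $ i $ k = (if k = j then 1 else 0)" for k
    using one_hot_cases[OF assms, of i k] j uniq by (cases "k = j") metis+
  then have "(\<Sum>k\<in>UNIV. Z $ i $ k) = (\<Sum>k\<in>UNIV. if k = j then 1 else 0)"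
    by (rule sum.cong[OF refl])
  then show ?thesis by simp
qed

lemma gram_one_hot:
  assumes "one_hot Z"
  shows "(transpose Z ** Z) $ j $ k = (if j = k then category_count Z j else 0)"
  by (simp add: matrix_matrix_mult_def transpose_def category_count_def one_hot_row_mult[OF assms])

lemma ols_matrix_nth:
  fixes Z :: "real^'p^'n"
  assumes Z: "one_hot Z" and pos: "\<And>j. category_count Z j > 0"
  shows "(matrix_inv (transpose Z ** Z) ** transpose Z) $ j $ i = Z $ i $ j / category_count Z j"
proof -
  let ?A = "transpose Z ** Z"
  \<comment> \<open>The explicit inverse: the Gram matrix is diagonal, so its diagonal entries are
    replaced by their reciprocals.\<close>
  define B :: "real^'p^'p" where "B = (\<chi> j k. if j = k then 1 / category_count Z j else 0)"
  have nz: "category_count Z j \<noteq> 0" for j using pos[of j] by simp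
  have "(?A ** B) $ j $ k = mat 1 $ j $ k" for j k
    unfolding matrix_matrix_mult_def[of ?A B]
    by (simp add: gram_one_hot[OF Z] B_def mat_def mult_delta_left nz)
  then have AB: "?A ** B = mat 1" by (simp add: vec_eq_iff)
  \<comment> \<open>\<open>matrix_inv\<close> is a choice among two-sided inverses, so one has to be
    exhibited first. For square matrices the right inverse \<open>B\<close> already is one, and
    associativity then identifies the chosen inverse with \<open>B\<close>.\<close>
  then have "?A ** B = mat 1 \<and> B ** ?A = mat 1"
    by (simp add: matrix_left_right_inverse)
  then have "matrix_inv ?A ** ?A = mat 1"
    unfolding matrix_inv_def by (rule someI2) simp
  then have "matrix_inv ?A ** (?A ** B) = B"
    by (simp add: matrix_mul_assoc)
  then have "matrix_inv ?A = B" by (simp add: AB)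
  then show ?thesis
    by (simp add: matrix_matrix_mult_def[of B]) (simp add: B_def transpose_def mult_delta_left)
qed

section \<open>Flows between true and predicted categories\<close>

text \<open>A product of 0/1 entries is the indicator that both equal 1. This turns the cardinality
  into an entry of \<open>transpose X ** Xt\<close>.\<close>

lemma flow_count_eq_sum:
  fixes X Xt :: "real^'p^'n"
  assumes "one_hot X" "one_hot Xt"
  shows "real (flow_count X Xt k j) = (\<Sum>i\<in>UNIV. X $ i $ k * Xt $ i $ j)"
proof -
  have "X $ i $ k * Xt $ i $ j = (if X $ i $ k = 1 \<and> Xt $ i $ j = 1 then 1 else 0)" for i
    using one_hot_cases[OF assms(1), of i k] one_hot_cases[OF assms(2), of i j] by auto
  then show ?thesis by (simp add: flow_count_def sum.If_cases)
qed

text \<open>Every observation is predicted into exactly one category: after the sums are swapped,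
  the rows of \<open>Xt\<close> sum to 1. The next lemma uses the rows of \<open>X\<close> in the
  same way.\<close>

lemma sum_flow_count_from:
  assumes "one_hot X" "one_hot Xt"
  shows "(\<Sum>k\<in>UNIV. real (flow_count X Xt j k)) = category_count X j"
  unfolding flow_count_eq_sum[OF assms] category_count_def
  by (subst sum.swap) (simp add: one_hot_row_sum[OF assms(2)] flip: sum_distrib_left)

lemma sum_flow_count_into:
  assumes "one_hot X" "one_hot Xt"
  shows "(\<Sum>k\<in>UNIV. real (flow_count X Xt k j)) = category_count Xt j"
  unfolding flow_count_eq_sum[OF assms] category_count_def
  by (subst sum.swap) (simp add: one_hot_row_sum[OF assms(1)] flip: sum_distrib_right)

text \<open>The observations of category \<open>j\<close> that do not leave it are the correctly
  classified ones. So the coefficient of \<beta>_j in the mixture is the diagonal term of the same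
  family of flows.\<close>

lemma category_count_minus_out_count:
  assumes "one_hot X" "one_hot Xt"
  shows "category_count X j - real (out_count X Xt j) = real (flow_count X Xt j j)"
  using sum.remove[of UNIV j "\<lambda>k. real (flow_count X Xt j k)"]
  by (simp add: out_count_def flip: sum_flow_count_from[OF assms])

section \<open>The least-squares matrix applied to the two designs\<close>

lemma ols_matrix_mult_design:
  fixes X Xt :: "real^'p^'n" and \<beta> :: "real^'p"
  assumes X: "one_hot X" and Xt: "one_hot Xt" and pos: "\<And>j. category_count Xt j > 0"
  shows "((matrix_inv (transpose Xt ** Xt) ** transpose Xt) *v (X *v \<beta>)) $ j
    = ((category_count X j - real (out_count X Xt j)) * \<beta> $ j
        + (\<Sum>k\<in>UNIV - {j}. real (flow_count X Xt k j) * \<beta> $ k)) / category_count Xt j"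
proof -
  have "((matrix_inv (transpose Xt ** Xt) ** transpose Xt) *v (X *v \<beta>)) $ j
      = (\<Sum>i\<in>UNIV. \<Sum>k\<in>UNIV. X $ i $ k * Xt $ i $ j * \<beta> $ k) / category_count Xt j"
    by (simp add: matrix_vector_mult_def[of "_ ** _"] ols_matrix_nth[OF Xt pos])
       (simp add: matrix_vector_mult_def sum_distrib_left sum_divide_distrib mult_ac)
  \<comment> \<open>Summing over observations first leaves, for each true category \<open>k\<close>,
    the flow from \<open>k\<close> to \<open>j\<close>.\<close>
  also have "(\<Sum>i\<in>UNIV. \<Sum>k\<in>UNIV. X $ i $ k * Xt $ i $ j * \<beta> $ k)
      = (\<Sum>k\<in>UNIV. real (flow_count X Xt k j) * \<beta> $ k)"
    by (subst sum.swap) (simp add: flow_count_eq_sum[OF X Xt] sum_distrib_right)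
  also have "\<dots> = real (flow_count X Xt j j) * \<beta> $ j
      + (\<Sum>k\<in>UNIV - {j}. real (flow_count X Xt k j) * \<beta> $ k)"
    by (simp add: sum.remove[of UNIV j])
  finally show ?thesis by (simp add: category_count_minus_out_count[OF X Xt])
qed

text \<open>Distinct columns are orthogonal, and a diagonal entry is a category count divided by
  itself. In the bias formula this produces the term -\<beta>_j.\<close>

lemma ols_matrix_mult_self:
  fixes Z :: "real^'p^'n"
  assumes Z: "one_hot Z" and pos: "\<And>j. category_count Z j > 0"
  shows "matrix_inv (transpose Z ** Z) ** transpose Z ** Z = mat 1"
proof -
  have "category_count Z j \<noteq> 0" for j using pos[of j] by simp
  then show ?thesis
    by (simp add: vec_eq_iff matrix_matrix_mult_def[of "_ ** _"] ols_matrix_nth[OF Z pos] mat_def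
        one_hot_row_mult[OF Z] flip: sum_divide_distrib)
       (simp add: category_count_def)
qed

section \<open>Conditional expectation given the two designs\<close>

lemma subalgebra_sigma_gen:
  assumes "Z \<in> borel_measurable M"
  shows "subalgebra M (sigma_gen M Z)"
  using assms unfolding subalgebra_def sigma_gen_def
  by (auto simp: sets_vimage_algebra2 measurable_sets)

lemma measurable_sigma_gen: "Z \<in> borel_measurable (sigma_gen M Z)"
  unfolding sigma_gen_def by (rule measurable_vimage_algebra1) simp

text \<open>The noise is centred given the pair \<open>G\<close> and not only given
  \<open>X\<close>, because the averaging weights depend on \<open>Xt\<close> and can be pulled out
  only if they are measurable for the conditioning sigma-algebra.\<close>

lemma (in prob_space) cond_mean_ols:
  fixes X Xt :: "'a \<Rightarrow> real^'p^'n" and \<epsilon> y :: "'a \<Rightarrow> real^'n"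
  defines "G \<equiv> \<lambda>w. (X w, Xt w)"
  assumes X: "X \<in> borel_measurable M" "\<And>w. w \<in> space M \<Longrightarrow> one_hot (X w)"
    and Xt: "Xt \<in> borel_measurable M" "\<And>w. w \<in> space M \<Longrightarrow> one_hot (Xt w)"
    and pos: "\<And>w j. w \<in> space M \<Longrightarrow> category_count (Xt w) j > 0"
    and y: "\<And>w. w \<in> space M \<Longrightarrow> y w = X w *v \<beta> + \<epsilon> w"
    and \<epsilon>: "\<And>i. integrable M (\<lambda>w. \<epsilon> w $ i)" "AE w in M. cond_mean M G \<epsilon> w = 0"
  shows "AE w in M. cond_mean M G (\<lambda>w. ols (Xt w) (y w)) w
      = (matrix_inv (transpose (Xt w) ** Xt w) ** transpose (Xt w)) *v (X w *v \<beta>)"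
proof -
  let ?F = "sigma_gen M G"
  have "G \<in> borel_measurable M" unfolding G_def using X(1) Xt(1) by measurable
  then interpret finite_measure_subalgebra M ?F
    by unfold_locales (rule subalgebra_sigma_gen)
  have meas_M: "f \<in> borel_measurable M" if "f \<in> borel_measurable ?F" for f :: "'a \<Rightarrow> real"
    by (rule measurable_from_subalg[OF subalg that])
  define S where "S w i j = Xt w $ i $ j / category_count (Xt w) j" for w i j
  define C where "C w i = (X w *v \<beta>) $ i" for w i
  \<comment> \<open>\<open>borel_prod\<close> identifies the Borel sets of the product type with the
    product sigma-algebra, which makes the two projections measurable.\<close>
  have "(\<lambda>w. fst (G w)) \<in> borel_measurable ?F" "(\<lambda>w. snd (G w)) \<in> borel_measurable ?F"
    using measurable_sigma_gen[of G M] by (auto simp flip: borel_prod)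
  then have [measurable]: "X \<in> borel_measurable ?F" "Xt \<in> borel_measurable ?F"
    by (simp_all add: G_def)
  have nth: "(\<lambda>w. Z w $ i $ j) \<in> borel_measurable ?F"
    if "Z \<in> borel_measurable ?F" for Z :: "'a \<Rightarrow> real^'p^'n" and i j
    by (rule measurable_compose[OF that], intro borel_measurable_continuous_onI continuous_intros)
  have [measurable]: "(\<lambda>w. X w $ i $ j) \<in> borel_measurable ?F"
    "(\<lambda>w. Xt w $ i $ j) \<in> borel_measurable ?F" for i j
    by (rule nth; measurable)+
  have S_F [measurable]: "(\<lambda>w. S w i j) \<in> borel_measurable ?F" for i j
    unfolding S_def category_count_def by measurable
  have C_F [measurable]: "(\<lambda>w. C w i) \<in> borel_measurable ?F" for i
    unfolding C_def matrix_vector_mult_def by simp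
  \<comment> \<open>The numerator is one of the nonnegative summands of the column count in the
    denominator. The bound keeps products with integrable functions integrable.\<close>
  have S_le: "\<bar>S w i j\<bar> \<le> 1" if "w \<in> space M" for w i j
  proof -
    have "0 \<le> Xt w $ i $ j" for i using one_hot_cases[OF Xt(2)[OF that], of i j] by auto
    then have "0 \<le> Xt w $ i $ j" "Xt w $ i $ j \<le> category_count (Xt w) j"
      by (auto simp: category_count_def intro: member_le_sum)
    then show ?thesis using pos[OF that, of j] by (simp add: S_def)
  qed
  have int_mult: "integrable M (\<lambda>w. S w i j * f w)" if "integrable M f" for f i j
  proof (rule Bochner_Integration.integrable_bound[OF that])
    show "(\<lambda>w. S w i j * f w) \<in> borel_measurable M"
      using meas_M[OF S_F] that by measurable
    show "AE w in M. norm (S w i j * f w) \<le> norm (f w)"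
      using S_le by (auto simp: abs_mult intro!: mult_left_le_one_le)
  qed
  have int_C: "integrable M (\<lambda>w. C w i)" for i
  proof (rule integrable_const_bound)
    have "\<bar>X w $ i $ k * \<beta> $ k\<bar> \<le> \<bar>\<beta> $ k\<bar>" if "w \<in> space M" for w k
      using one_hot_cases[OF X(2)[OF that], of i k] by auto
    then show "AE w in M. norm (C w i) \<le> (\<Sum>k\<in>UNIV. \<bar>\<beta> $ k\<bar>)"
      by (auto simp: C_def matrix_vector_mult_def intro!: order_trans[OF sum_abs] sum_mono)
  qed (rule meas_M[OF C_F])
  have ols_eq: "ols (Xt w) (y w) $ j = (\<Sum>i\<in>UNIV. S w i j * C w i) + (\<Sum>i\<in>UNIV. S w i j * \<epsilon> w $ i)"
    if "w \<in> space M" for w j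
    by (simp add: ols_def y[OF that] matrix_vector_right_distrib C_def S_def
        matrix_vector_mult_def[of "_ ** _"] ols_matrix_nth[OF Xt(2) pos] that)
  have "AE w in M. real_cond_exp M ?F (\<lambda>w. ols (Xt w) (y w) $ j) w = (\<Sum>i\<in>UNIV. S w i j * C w i)" for j
  proof -
    let ?f = "\<lambda>w. \<Sum>i\<in>UNIV. S w i j * C w i" and ?g = "\<lambda>w. \<Sum>i\<in>UNIV. S w i j * \<epsilon> w $ i"
    have fg: "integrable M ?f" "integrable M ?g"
      using int_mult int_C \<epsilon>(1) by auto
    have [measurable]: "(\<lambda>w. \<epsilon> w $ i) \<in> borel_measurable M" for i
      using \<epsilon>(1) by auto
    have "AE w in M. real_cond_exp M ?F (\<lambda>w. ols (Xt w) (y w) $ j) w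
        = real_cond_exp M ?F (\<lambda>w. ?f w + ?g w) w"
    proof (rule real_cond_exp_cong)
      show fg_meas: "(\<lambda>w. ?f w + ?g w) \<in> borel_measurable M" using fg by auto
      \<comment> \<open>Measurability of \<open>y\<close> is not assumed; that of the estimator
        comes from its decomposition, which holds at every point of the space.\<close>
      show "(\<lambda>w. ols (Xt w) (y w) $ j) \<in> borel_measurable M"
        using fg_meas by (subst measurable_cong[OF ols_eq])
    qed (auto simp: ols_eq)
    moreover have "AE w in M. real_cond_exp M ?F (\<lambda>w. ?f w + ?g w) w
        = real_cond_exp M ?F ?f w + real_cond_exp M ?F ?g w"
      using fg by (rule real_cond_exp_add)
    moreover have "AE w in M. real_cond_exp M ?F ?f w = ?f w"
      by (rule real_cond_exp_F_meas[OF fg(1)]) measurable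
    moreover have "AE w in M. real_cond_exp M ?F ?g w
        = (\<Sum>i\<in>UNIV. real_cond_exp M ?F (\<lambda>w. S w i j * \<epsilon> w $ i) w)"
      by (rule real_cond_exp_sum) (rule int_mult[OF \<epsilon>(1)])
    \<comment> \<open>The pull-out property, with the null sets of the finitely many indices merged
      into one so that it can be applied inside the sum.\<close>
    moreover have "AE w in M. \<forall>i. real_cond_exp M ?F (\<lambda>w. S w i j * \<epsilon> w $ i) w
        = S w i j * real_cond_exp M ?F (\<lambda>w. \<epsilon> w $ i) w"
      unfolding AE_all_countable
      by (intro allI real_cond_exp_mult int_mult \<epsilon>(1)) measurable
    ultimately show ?thesis
      using \<epsilon>(2) by eventually_elim (simp add: cond_mean_def vec_eq_iff)
  qed
  then have "AE w in M. \<forall>j. real_cond_exp M ?F (\<lambda>w. ols (Xt w) (y w) $ j) w = (\<Sum>i\<in>UNIV. S w i j * C w i)"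
    unfolding AE_all_countable by blast
  with AE_space show ?thesis
    by eventually_elim
      (simp add: vec_eq_iff cond_mean_def S_def C_def matrix_vector_mult_def[of "_ ** _"]
        ols_matrix_nth[OF Xt(2) pos])
qed

section \<open>Bias formula and mixture representation\<close>

theorem mainTheorem2:
  fixes M :: "'a measure"
    and X Xt :: "'a \<Rightarrow> real^'p^'n"
    and y \<epsilon> :: "'a \<Rightarrow> real^'n"
    and \<beta> :: "real^'p"
    and \<sigma> :: real
  assumes "prob_space M"
    and "X \<in> borel_measurable M" and "Xt \<in> borel_measurable M"
    and "\<And>\<omega>. \<omega> \<in> space M \<Longrightarrow> one_hot (X \<omega>)"
    and "\<And>\<omega>. \<omega> \<in> space M \<Longrightarrow> one_hot (Xt \<omega>)"
    and "\<And>\<omega> j. \<omega> \<in> space M \<Longrightarrow> category_count (Xt \<omega>) j > 0"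
    and "\<And>\<omega>. \<omega> \<in> space M \<Longrightarrow> y \<omega> = X \<omega> *v \<beta> + \<epsilon> \<omega>"
    and "\<And>i. integrable M (\<lambda>\<omega>. \<epsilon> \<omega> $ i)"
    and "\<And>i. integrable M (\<lambda>\<omega>. (\<epsilon> \<omega> $ i)\<^sup>2)"
    and "AE \<omega> in M. cond_mean M X \<epsilon> \<omega> = 0"
    and "AE \<omega> in M. cond_var M X \<epsilon> \<omega> = \<sigma>\<^sup>2 *\<^sub>R mat 1"
  shows
    \<comment> \<open>bias due to misclassification\<close>
    "(\<forall>\<omega>\<in>space M. \<forall>j.
        (- (matrix_inv (transpose (Xt \<omega>) ** Xt \<omega>) ** transpose (Xt \<omega>) ** (Xt \<omega> - X \<omega>)) *v \<beta>) $ j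
        = - \<beta> $ j
          + ((category_count (X \<omega>) j - real (out_count (X \<omega>) (Xt \<omega>) j)) * \<beta> $ j
             + (\<Sum>k\<in>UNIV - {j}. real (flow_count (X \<omega>) (Xt \<omega>) k j) * \<beta> $ k))
            / category_count (Xt \<omega>) j)
   \<and> \<comment> \<open>the estimator minus its sampling-noise term\<close>
     (\<forall>\<omega>\<in>space M. \<forall>j.
        (ols (Xt \<omega>) (y \<omega>)
          - (matrix_inv (transpose (Xt \<omega>) ** Xt \<omega>) ** transpose (Xt \<omega>)) *v \<epsilon> \<omega>) $ j
        = ((category_count (X \<omega>) j - real (out_count (X \<omega>) (Xt \<omega>) j)) * \<beta> $ j
             + (\<Sum>k\<in>UNIV - {j}. real (flow_count (X \<omega>) (Xt \<omega>) k j) * \<beta> $ k))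
            / category_count (Xt \<omega>) j)
   \<and> \<comment> \<open>the mixture weights are nonnegative and sum to one\<close>
     (\<forall>\<omega>\<in>space M. \<forall>j.
        0 \<le> (category_count (X \<omega>) j - real (out_count (X \<omega>) (Xt \<omega>) j)) / category_count (Xt \<omega>) j
        \<and> (\<forall>k\<in>UNIV - {j}. 0 \<le> real (flow_count (X \<omega>) (Xt \<omega>) k j) / category_count (Xt \<omega>) j)
        \<and> (category_count (X \<omega>) j - real (out_count (X \<omega>) (Xt \<omega>) j)) / category_count (Xt \<omega>) j
            + (\<Sum>k\<in>UNIV - {j}. real (flow_count (X \<omega>) (Xt \<omega>) k j) / category_count (Xt \<omega>) j) = 1)
   \<and> \<comment> \<open>conditional mean, when the proxy carries no information on the noise mean beyond \<open>X\<close>\<close>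
     ((AE \<omega> in M. cond_mean M (\<lambda>w. (X w, Xt w)) \<epsilon> \<omega> = cond_mean M X \<epsilon> \<omega>) \<longrightarrow>
      (AE \<omega> in M. \<forall>j.
        cond_mean M (\<lambda>w. (X w, Xt w)) (\<lambda>w. ols (Xt w) (y w)) \<omega> $ j
        = ((category_count (X \<omega>) j - real (out_count (X \<omega>) (Xt \<omega>) j)) * \<beta> $ j
             + (\<Sum>k\<in>UNIV - {j}. real (flow_count (X \<omega>) (Xt \<omega>) k j) * \<beta> $ k))
            / category_count (Xt \<omega>) j))"
proof (intro conjI ballI allI impI)
  interpret prob_space M by fact
  note X = assms(4) and Xt = assms(5) and pos = assms(6)
  note mixture = ols_matrix_mult_design[OF X Xt pos]
  show "(- (matrix_inv (transpose (Xt \<omega>) ** Xt \<omega>) ** transpose (Xt \<omega>) ** (Xt \<omega> - X \<omega>)) *v \<beta>) $ j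
        = - \<beta> $ j
          + ((category_count (X \<omega>) j - real (out_count (X \<omega>) (Xt \<omega>) j)) * \<beta> $ j
             + (\<Sum>k\<in>UNIV - {j}. real (flow_count (X \<omega>) (Xt \<omega>) k j) * \<beta> $ k))
            / category_count (Xt \<omega>) j" if "\<omega> \<in> space M" for \<omega> j
  proof -
    let ?P = "matrix_inv (transpose (Xt \<omega>) ** Xt \<omega>) ** transpose (Xt \<omega>)"
    have neg: "- A *v v = - (A *v v)" for A :: "real^'p^'p" and v
      by (simp add: vec_eq_iff matrix_vector_mult_def sum_negf)
    \<comment> \<open>Splitting the error matrix: \<open>?P\<close> is a left inverse of the
      predicted design, so the first term becomes -\<beta>, and the second is the mixture.\<close>
    have "- (?P ** (Xt \<omega> - X \<omega>)) *v \<beta> = - ((?P ** Xt \<omega>) *v \<beta>) + ?P *v (X \<omega> *v \<beta>)"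
      by (simp add: neg matrix_vector_mult_diff_rdistrib matrix_vector_mult_diff_distrib
          flip: matrix_vector_mul_assoc)
    then show ?thesis
      by (simp add: ols_matrix_mult_self[OF Xt pos] that mixture)
  qed
  show "(ols (Xt \<omega>) (y \<omega>)
          - (matrix_inv (transpose (Xt \<omega>) ** Xt \<omega>) ** transpose (Xt \<omega>)) *v \<epsilon> \<omega>) $ j
        = ((category_count (X \<omega>) j - real (out_count (X \<omega>) (Xt \<omega>) j)) * \<beta> $ j
             + (\<Sum>k\<in>UNIV - {j}. real (flow_count (X \<omega>) (Xt \<omega>) k j) * \<beta> $ k))
            / category_count (Xt \<omega>) j" if "\<omega> \<in> space M" for \<omega> j
    by (simp add: ols_def assms(7) matrix_vector_right_distrib that mixture)
  show "0 \<le> (category_count (X \<omega>) j - real (out_count (X \<omega>) (Xt \<omega>) j)) / category_count (Xt \<omega>) j"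
    if "\<omega> \<in> space M" for \<omega> j
    using pos[OF that, of j] by (simp add: category_count_minus_out_count[OF X Xt] that)
  show "0 \<le> real (flow_count (X \<omega>) (Xt \<omega>) k j) / category_count (Xt \<omega>) j"
    if "\<omega> \<in> space M" for \<omega> j k
    using pos[OF that, of j] by simp
  show "(category_count (X \<omega>) j - real (out_count (X \<omega>) (Xt \<omega>) j)) / category_count (Xt \<omega>) j
      + (\<Sum>k\<in>UNIV - {j}. real (flow_count (X \<omega>) (Xt \<omega>) k j) / category_count (Xt \<omega>) j) = 1"
    if "\<omega> \<in> space M" for \<omega> j
  proof -
    \<comment> \<open>All flows into \<open>j\<close>, the diagonal one included, add up to the
      predicted count, so normalised by it they sum to 1.\<close>
    have "real (flow_count (X \<omega>) (Xt \<omega>) j j) + (\<Sum>k\<in>UNIV - {j}. real (flow_count (X \<omega>) (Xt \<omega>) k j))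
        = category_count (Xt \<omega>) j"
      using sum.remove[of UNIV j "\<lambda>k. real (flow_count (X \<omega>) (Xt \<omega>) k j)"]
      by (simp flip: sum_flow_count_into[OF X[OF that] Xt[OF that]])
    then show ?thesis
      using pos[OF that, of j]
      by (simp add: category_count_minus_out_count[OF X Xt] that
          flip: sum_divide_distrib add_divide_distrib)
  qed
  \<comment> \<open>A proxy may depend on the noise, so centring given \<open>X\<close> alone does
    not in general give centring given the pair. This premise transfers it.\<close>
  assume "AE \<omega> in M. cond_mean M (\<lambda>w. (X w, Xt w)) \<epsilon> \<omega> = cond_mean M X \<epsilon> \<omega>"
  with assms(10) have "AE \<omega> in M. cond_mean M (\<lambda>w. (X w, Xt w)) \<epsilon> \<omega> = 0"
    by eventually_elim simp
  with assms(2,3,8) X Xt pos assms(7)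
  have "AE \<omega> in M. cond_mean M (\<lambda>w. (X w, Xt w)) (\<lambda>w. ols (Xt w) (y w)) \<omega>
      = (matrix_inv (transpose (Xt \<omega>) ** Xt \<omega>) ** transpose (Xt \<omega>)) *v (X \<omega> *v \<beta>)"
    by (intro cond_mean_ols)
  with AE_space show "AE \<omega> in M. \<forall>j.
        cond_mean M (\<lambda>w. (X w, Xt w)) (\<lambda>w. ols (Xt w) (y w)) \<omega> $ j
        = ((category_count (X \<omega>) j - real (out_count (X \<omega>) (Xt \<omega>) j)) * \<beta> $ j
             + (\<Sum>k\<in>UNIV - {j}. real (flow_count (X \<omega>) (Xt \<omega>) k j) * \<beta> $ k))
            / category_count (Xt \<omega>) j"
    by eventually_elim (simp add: mixture)
qed

end
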